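(* There is an algorithm with competitive-ratio $3-2\sqrt2$ (i.e. a $(3-2\sqrt2)$-competitive algorithm) for two-faced online weighted bipartite matching with one-sided vertex arrivals.
   Context: Two-faced online bipartite matching with vertex arrivals: there is a finite bipartite graph $G=(L,R,E)$ known to the algorithm. For each $u\in L$ the adversary chooses a pair of non-negative weight vectors $f_1(u),f_2(u)$ for the edges incident to $u$. Independently for each $u\in L$, $s(u)\in\{f_1(u),f_2(u)\}$ is chosen uniformly at random and $w(u)$ is the remaining vector. All vectors $s(u)$, $u\in L$, are given to the online algorithm upfront as a sample. Then the vertices $u\in L$ arrive one by one in an adversarial order (which may depend on the realization of $s$ and $w$); when $u$ arrives, the weight vector $w(u)$ of its incident edges is revealed, and the algorithm must immediately and irrevocably match $u$ to a currently unmatched neighbor in $R$ or leave it unmatched. $\mathrm{ALG}$ is the total $w$-weight of the output matching and $\mathrm{OPT}$ is the maximum $w$-weight of a matching in $G$. An algorithm is $c$-competitive if $\mathrm{E}[\mathrm{ALG}]\ge c\cdot\mathrm{E}[\mathrm{OPT}]$ on every instance $(G,f_1,f_2)$, with expectation over the random choice of $s$ (and $w$) and the algorithm's internal randomness. *)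

theory Defs
  imports "HOL-Probability.Probability" "HOL-Probability.Product_PMF"
begin

record ('l, 'r) bigraph =
  lefts :: "'l set"
  rights :: "'r set"
  edges :: "('l \<times> 'r) set"

definition finite_bigraph :: "('l, 'r) bigraph \<Rightarrow> bool" where
  "finite_bigraph G \<longleftrightarrow>
     finite (lefts G) \<and> finite (rights G) \<and> edges G \<subseteq> lefts G \<times> rights G"

definition matching :: "('l, 'r) bigraph \<Rightarrow> ('l \<times> 'r) set \<Rightarrow> bool" where
  "matching G M \<longleftrightarrow> M \<subseteq> edges G \<and>
     (\<forall>u v u' v'. (u, v) \<in> M \<longrightarrow> (u', v') \<in> M \<longrightarrow> (u = u' \<longleftrightarrow> v = v'))"

text \<open>\<open>w u\<close> is the weight vector of the edges incident to \<open>u\<close>; since it is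
  represented by a total function, it is normalised to \<open>0\<close> on pairs that are not edges.\<close>

type_synonym ('l, 'r) weighting = "'l \<Rightarrow> 'r \<Rightarrow> real"

definition edge_weighting :: "('l, 'r) bigraph \<Rightarrow> ('l, 'r) weighting \<Rightarrow> bool" where
  "edge_weighting G w \<longleftrightarrow>
     (\<forall>u v. 0 \<le> w u v) \<and> (\<forall>u v. (u, v) \<notin> edges G \<longrightarrow> w u v = 0)"

definition weight :: "('l, 'r) weighting \<Rightarrow> ('l \<times> 'r) set \<Rightarrow> real" where
  "weight w M = (\<Sum>(u, v)\<in>M. w u v)"

definition OPT :: "('l, 'r) bigraph \<Rightarrow> ('l, 'r) weighting \<Rightarrow> real" where
  "OPT G w = Max (weight w ` {M. matching G M})"

text \<open>The outcome \<open>b u\<close> of a fair coin tells which of \<open>f1 u\<close>, \<open>f2 u\<close> goes to the sample;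
  the other one becomes the real weight vector of \<open>u\<close>.\<close>

definition coins :: "('l, 'r) bigraph \<Rightarrow> ('l \<Rightarrow> bool) pmf" where
  "coins G = Pi_pmf (lefts G) False (\<lambda>_. bernoulli_pmf (1/2))"

definition sample ::
  "('l, 'r) weighting \<Rightarrow> ('l, 'r) weighting \<Rightarrow> ('l \<Rightarrow> bool) \<Rightarrow> ('l, 'r) weighting" where
  "sample f1 f2 b = (\<lambda>u. if b u then f1 u else f2 u)"

definition remaining ::
  "('l, 'r) weighting \<Rightarrow> ('l, 'r) weighting \<Rightarrow> ('l \<Rightarrow> bool) \<Rightarrow> ('l, 'r) weighting" where
  "remaining f1 f2 b = (\<lambda>u. if b u then f2 u else f1 u)"

text \<open>A deterministic online algorithm decides about the vertex arriving last, knowing only the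
  sample and the arrivals so far: the list contains the arrived vertices with their revealed
  weight vectors in order of arrival, the current vertex being its last element. The answer
  \<open>None\<close> leaves the current vertex unmatched. Past decisions need not be passed, as they are
  determined by the sample and the prefixes of this list.\<close>

type_synonym ('l, 'r) online_algorithm =
  "('l, 'r) weighting \<Rightarrow> ('l \<times> ('r \<Rightarrow> real)) list \<Rightarrow> 'r option"

definition arrival_order :: "('l, 'r) bigraph \<Rightarrow> 'l list \<Rightarrow> bool" where
  "arrival_order G us \<longleftrightarrow> distinct us \<and> set us = lefts G"

definition alg_matching ::
  "('l, 'r) online_algorithm \<Rightarrow> ('l, 'r) weighting \<Rightarrow> ('l, 'r) weighting \<Rightarrow> 'l list
     \<Rightarrow> ('l \<times> 'r) set" where
  "alg_matching D s w us =
     {(us ! i, v) | i v. i < length us \<and>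
        D s (map (\<lambda>u. (u, w u)) (take (Suc i) us)) = Some v}"

text \<open>As decisions are irrevocable and every left vertex arrives once, the output is a matching
  iff each arriving vertex is matched to a neighbour that is unmatched at that time, or not
  matched at all.\<close>

definition feasible :: "('l, 'r) bigraph \<Rightarrow> ('l, 'r) online_algorithm \<Rightarrow> bool" where
  "feasible G D \<longleftrightarrow>
     (\<forall>s w us. edge_weighting G s \<longrightarrow> edge_weighting G w \<longrightarrow> arrival_order G us
        \<longrightarrow> matching G (alg_matching D s w us))"

text \<open>A randomized algorithm knows the graph and draws a deterministic online algorithm; the
  draw is its internal randomness, independent of the coins.\<close>

type_synonym ('l, 'r) randomized_algorithm =
  "('l, 'r) bigraph \<Rightarrow> ('l, 'r) online_algorithm pmf"

definition valid_algorithm :: "('l, 'r) randomized_algorithm \<Rightarrow> bool" where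
  "valid_algorithm A \<longleftrightarrow> (\<forall>G. finite_bigraph G \<longrightarrow> (\<forall>D\<in>set_pmf (A G). feasible G D))"

text \<open>The adversary's arrival order \<open>ord\<close> may depend on the realized sample and weights, but not
  on the internal randomness of the algorithm.\<close>

definition expected_ALG ::
  "('l, 'r) randomized_algorithm \<Rightarrow> ('l, 'r) bigraph \<Rightarrow> ('l, 'r) weighting \<Rightarrow> ('l, 'r) weighting
     \<Rightarrow> (('l, 'r) weighting \<Rightarrow> ('l, 'r) weighting \<Rightarrow> 'l list) \<Rightarrow> real" where
  "expected_ALG A G f1 f2 ord =
     measure_pmf.expectation (pair_pmf (coins G) (A G))
       (\<lambda>(b, D). let s = sample f1 f2 b; w = remaining f1 f2 b
                 in weight w (alg_matching D s w (ord s w)))"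

definition expected_OPT ::
  "('l, 'r) bigraph \<Rightarrow> ('l, 'r) weighting \<Rightarrow> ('l, 'r) weighting \<Rightarrow> real" where
  "expected_OPT G f1 f2 =
     measure_pmf.expectation (coins G) (\<lambda>b. OPT G (remaining f1 f2 b))"

definition competitive :: "real \<Rightarrow> ('l, 'r) randomized_algorithm \<Rightarrow> bool" where
  "competitive c A \<longleftrightarrow>
     (\<forall>G f1 f2 ord. finite_bigraph G \<longrightarrow> edge_weighting G f1 \<longrightarrow> edge_weighting G f2 \<longrightarrow>
        (\<forall>s w. arrival_order G (ord s w)) \<longrightarrow>
        expected_ALG A G f1 f2 ord \<ge> c * expected_OPT G f1 f2)"

end

theory Submission
  imports Defs
begin

text \<open>The algorithm designates every left vertex independently, with probability
  \<open>p = sqrt 2 - 1\<close>, as a sampled vertex, of which it uses only \<open>s u\<close>; of every other vertex it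
  uses only \<open>w u\<close>. The vectors used are distributed like \<open>w\<close>, independently of the designation
  \<open>X\<close>. On them, scan the edges by decreasing weight and consider the edge \<open>(u, r)\<close> if \<open>u\<close> has not
  been considered before and \<open>r\<close> is still open. If \<open>u\<close> is designated, the edge closes \<open>r\<close>;
  otherwise \<open>r\<close> is the candidate of \<open>u\<close>, which depends only on the sample and on \<open>w u\<close>. An
  arriving vertex gets its candidate if that is still unmatched.

  Let \<open>C\<close> be the expected total weight of the considered edges. Charging each edge of an optimal
  matching to the edge that considered its left end or closed its right end gives
  \<open>OPT \<le> (1 + p) C\<close>. A considered edge \<open>(u, r)\<close> has an undesignated left end with
  probability \<open>1 - p\<close>, and then it is the last one with candidate \<open>r\<close> with probability at least
  \<open>p\<close>; whatever the arrival order, \<open>r\<close> earns at least the weight of the last such edge. So the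
  ratio is at least \<open>p (1 - p) / (1 + p) = 3 - 2 sqrt 2\<close>.\<close>

section \<open>Scanning the edges\<close>

text \<open>\<open>U\<close> holds the left vertices considered so far, \<open>C\<close> the closed
  right vertices. An undesignated left end closes nothing, so several considered edges may share a
  right end.\<close>

primrec considered ::
  "('l \<times> 'r) list \<Rightarrow> 'l set \<Rightarrow> 'r set \<Rightarrow> ('l \<Rightarrow> bool) \<Rightarrow> ('l \<times> 'r) list" where
  "considered [] U C X = []"
| "considered (e # es) U C X =
     (if fst e \<in> U \<or> snd e \<in> C then considered es U C X
      else e # considered es (insert (fst e) U) (if X (fst e) then insert (snd e) C else C) X)"

definition sampled where
  "sampled es U C X = filter (\<lambda>e. X (fst e)) (considered es U C X)"

definition candidates where
  "candidates es U C X = filter (\<lambda>e. \<not> X (fst e)) (considered es U C X)"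

lemma set_considered:
  "e \<in> set (considered es U C X) \<Longrightarrow> e \<in> set es \<and> fst e \<notin> U \<and> snd e \<notin> C"
  by (induction es arbitrary: U C) (auto split: if_splits)

lemma distinct_considered: "distinct (map fst (considered es U C X))"
  by (induction es arbitrary: U C) (auto dest: set_considered)

lemma considered_sorted:
  "sorted_wrt P es \<Longrightarrow> sorted_wrt P (considered es U C X)"
  by (induction es arbitrary: U C) (auto dest: set_considered)

text \<open>The scan reads \<open>X v\<close> only when it considers an edge of \<open>v\<close>,
  which puts \<open>v\<close> into \<open>U\<close>.\<close>

lemma considered_cong:
  "(\<And>v. v \<notin> U \<Longrightarrow> X v = Y v) \<Longrightarrow> considered es U C X = considered es U C Y"
proof (induction es arbitrary: U C)
  case (Cons e es)
  then show ?case
    using Cons.IH[of U C] Cons.IH[of "insert (fst e) U"] by simp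
qed simp

lemma considered_upd: "v \<in> U \<Longrightarrow> considered es U C (X(v := b)) = considered es U C X"
  by (rule considered_cong) auto

lemma sampled_upd: "v \<in> U \<Longrightarrow> sampled es U C (X(v := b)) = sampled es U C X"
  by (auto simp: sampled_def considered_upd intro!: filter_cong dest: set_considered)

lemma candidates_upd: "v \<in> U \<Longrightarrow> candidates es U C (X(v := b)) = candidates es U C X"
  by (auto simp: candidates_def considered_upd intro!: filter_cong dest: set_considered)

text \<open>Undesignated vertices other than \<open>u\<close> do not influence what happens to \<open>u\<close>.\<close>

lemma filter_considered:
  assumes "\<And>v. X v \<or> v = u \<Longrightarrow> v \<in> U \<longleftrightarrow> v \<in> U'"
  shows "filter (\<lambda>e. X (fst e) \<or> fst e = u) (considered es U C X) =
    considered (filter (\<lambda>e. X (fst e) \<or> fst e = u) es) U' C X"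
  using assms
proof (induction es arbitrary: U U' C)
  case (Cons e es)
  show ?case
  proof (cases "X (fst e) \<or> fst e = u")
    case True
    have 1: "fst e \<in> U \<longleftrightarrow> fst e \<in> U'" using True Cons.prems by blast
    have 2: "v \<in> insert (fst e) U \<longleftrightarrow> v \<in> insert (fst e) U'" if "X v \<or> v = u" for v
      using Cons.prems[OF that] by simp
    show ?thesis using 1 True Cons.IH[OF Cons.prems] Cons.IH[OF 2] by simp
  next
    case False
    have 2: "v \<in> insert (fst e) U \<longleftrightarrow> v \<in> U'" if "X v \<or> v = u" for v
      using Cons.prems[OF that] False that by auto
    show ?thesis using False Cons.IH[OF Cons.prems] Cons.IH[OF 2] by simp
  qed
qed simp

section \<open>Weights of scanned edges\<close>

abbreviation total :: "('l, 'r) weighting \<Rightarrow> ('l \<times> 'r) list \<Rightarrow> real" where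
  "total f es \<equiv> sum_list (map (\<lambda>e. f (fst e) (snd e)) es)"

abbreviation decreasing :: "('l, 'r) weighting \<Rightarrow> ('l \<times> 'r) list \<Rightarrow> bool" where
  "decreasing f \<equiv> sorted_wrt (\<lambda>d e. f (fst e) (snd e) \<le> f (fst d) (snd d))"

text \<open>Counts only the last edge at each right vertex. In a decreasing list this is the
  lightest one, a lower bound for whichever edge the vertex receives.\<close>

primrec last_total :: "('l, 'r) weighting \<Rightarrow> ('l \<times> 'r) list \<Rightarrow> real" where
  "last_total f [] = 0"
| "last_total f (e # es) =
     (if snd e \<in> snd ` set es then 0 else f (fst e) (snd e)) + last_total f es"

lemma last_total_le:
  assumes "decreasing f es"
    and "\<And>r. r \<in> snd ` set es \<Longrightarrow> \<exists>e\<in>set es. snd e = r \<and> f (fst e) (snd e) \<le> h r"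
  shows "last_total f es \<le> (\<Sum>r\<in>snd ` set es. h r)"
  using assms
proof (induction es)
  case (Cons e es)
  have "\<exists>d\<in>set es. snd d = r \<and> f (fst d) (snd d) \<le> h r" if r: "r \<in> snd ` set es" for r
  proof -
    have "r \<in> snd ` set (e # es)" using r by simp
    from Cons.prems(2)[OF this]
    obtain d where d: "d \<in> set (e # es)" "snd d = r" "f (fst d) (snd d) \<le> h r"
      by (elim bexE conjE)
    show ?thesis
    proof (cases "d = e")
      \<comment> \<open>If the witness is \<open>e\<close> itself, any later edge at
        \<open>r\<close> is no heavier and takes over its role.\<close>
      case True
      obtain d' where "d' \<in> set es" "snd d' = r" using r by auto
      moreover have "f (fst d') (snd d') \<le> f (fst e) (snd e)"
        using Cons.prems(1) \<open>d' \<in> set es\<close> by simp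
      ultimately show ?thesis using d(3) True by force
    next
      case False
      then show ?thesis using d by auto
    qed
  qed
  then have IH: "last_total f es \<le> (\<Sum>r\<in>snd ` set es. h r)"
    using Cons.IH Cons.prems(1) by simp
  show ?case
  proof (cases "snd e \<in> snd ` set es")
    case True
    then show ?thesis using IH by (simp add: insert_absorb)
  next
    case False
    have "f (fst e) (snd e) \<le> h (snd e)"
      using Cons.prems(2)[of "snd e"] False by (force simp: image_iff)
    then show ?thesis using IH False by simp
  qed
qed simp

text \<open>Whatever blocks an edge of \<open>M\<close> comes no later in the list, so it is at
  least as heavy. A considered edge is charged at most once through its left end and, only if it is
  sampled, once more through its right end.\<close>

lemma weight_le_considered:
  assumes "decreasing f es" and "\<And>u r. 0 \<le> f u r"
    and "M \<subseteq> set es" and "inj_on fst M" and "inj_on snd M"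
    and "fst ` M \<inter> U = {}" and "snd ` M \<inter> C = {}"
  shows "weight f M \<le> total f (considered es U C X) + total f (sampled es U C X)"
  using assms
proof (induction es arbitrary: U C M)
  case Nil
  then show ?case by (simp add: weight_def sampled_def)
next
  case (Cons e es)
  let ?w = "\<lambda>e. f (fst e) (snd e)"
  have fin: "finite M" using Cons.prems(3) finite_subset by blast
  have W: "weight f N = sum ?w N" for N
    by (simp add: weight_def case_prod_beta)
  show ?case
  proof (cases "fst e \<in> U \<or> snd e \<in> C")
    case True
    have "e \<notin> M" using True Cons.prems(6,7) by auto
    then have "M \<subseteq> set es" using Cons.prems(3) by auto
    then show ?thesis
      using Cons.IH[of M U C] Cons.prems True by (simp add: sampled_def)
  next
    case False
    define C' where "C' = (if X (fst e) then insert (snd e) C else C)"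
    \<comment> \<open>\<open>A\<close> and \<open>B\<close> are the edges of \<open>M\<close>
      blocked by \<open>e\<close> through its left end and its closed right end; \<open>B\<close>
      excludes \<open>A\<close> to avoid double counting. \<open>N\<close> is left for the induction
      hypothesis.\<close>
    define A where "A = {d \<in> M. fst d = fst e}"
    define B where "B = {d \<in> M. X (fst e) \<and> fst d \<noteq> fst e \<and> snd d = snd e}"
    define N where "N = M - A - B"
    have le: "?w d \<le> ?w e" if "d \<in> M" for d
      using Cons.prems(1,3) that by auto
    have single: "sum ?w S \<le> ?w e" if S: "S \<subseteq> M" "\<forall>d\<in>S. \<forall>d'\<in>S. d = d'" for S
    proof (cases "S = {}")
      case True
      then show ?thesis using Cons.prems(2) by simp
    next
      case False
      then obtain d where "S = {d}" using S(2) by blast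
      then show ?thesis using le S(1) by simp
    qed
    have A: "sum ?w A \<le> ?w e"
      using Cons.prems(4) by (intro single) (auto simp: A_def inj_on_def)
    have B: "sum ?w B \<le> (if X (fst e) then ?w e else 0)"
    proof (cases "X (fst e)")
      case True
      have "sum ?w B \<le> ?w e"
        using Cons.prems(5) by (intro single) (auto simp: B_def inj_on_def)
      then show ?thesis using True by simp
    qed (simp add: B_def)
    have "N \<subseteq> set es"
      using Cons.prems(3) by (auto simp: N_def A_def)
    moreover have "inj_on fst N" "inj_on snd N"
      using Cons.prems(4,5) by (auto simp: N_def inj_on_def)
    moreover have "fst ` N \<inter> insert (fst e) U = {}"
      using Cons.prems(6) by (auto simp: N_def A_def)
    moreover have "snd ` N \<inter> C' = {}"
      using Cons.prems(7) by (auto simp: N_def A_def B_def C'_def)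
    ultimately have N: "weight f N \<le> total f (considered es (insert (fst e) U) C' X)
        + total f (sampled es (insert (fst e) U) C' X)"
      using Cons.IH[of N "insert (fst e) U" C'] Cons.prems(1,2) by simp
    have "sum ?w M = sum ?w A + sum ?w (M - A)"
      using fin sum.subset_diff[of A M ?w] by (simp add: A_def add.commute)
    also have "sum ?w (M - A) = sum ?w B + sum ?w N"
      unfolding N_def using fin
      by (subst sum.subset_diff[of B]) (auto simp: A_def B_def)
    finally show ?thesis
      using A B N False by (simp add: W sampled_def C'_def split: if_splits)
  qed
qed

section \<open>Expectation over the designation\<close>

abbreviation designation :: "real \<Rightarrow> 'l set \<Rightarrow> ('l \<Rightarrow> bool) pmf" where
  "designation p L \<equiv> Pi_pmf L False (\<lambda>_. bernoulli_pmf p)"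

lemma finite_set_designation: "finite L \<Longrightarrow> finite (set_pmf (designation p L))"
  by (rule finite_subset[OF set_Pi_pmf_subset']) (auto intro!: finite_PiE_dflt)

lemma designation_outside:
  assumes "finite L" "X \<in> set_pmf (designation p L)" "u \<notin> L"
  shows "\<not> X u"
proof -
  have "X \<in> {f. \<forall>x. x \<notin> L \<longrightarrow> f x = False}"
    using assms(2) by (rule subsetD[OF set_Pi_pmf_subset[OF assms(1)]])
  then show ?thesis using assms(3) by simp
qed

lemma integrable_designation:
  fixes g :: "('l \<Rightarrow> bool) \<Rightarrow> real"
  shows "finite L \<Longrightarrow> integrable (measure_pmf (designation p L)) g"
  by (intro integrable_measure_pmf_finite finite_set_designation)

text \<open>Conditions on the coin of \<open>u\<close> but keeps the index set \<open>L\<close> by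
  overwriting the value at \<open>u\<close>, so that inductions along the scan stay within one
  distribution.\<close>

lemma expectation_split:
  fixes g :: "('l \<Rightarrow> bool) \<Rightarrow> real"
  assumes L: "finite L" "u \<in> L" and p: "0 \<le> p" "p \<le> 1"
  shows "measure_pmf.expectation (designation p L) g =
    p * measure_pmf.expectation (designation p L) (\<lambda>X. g (X(u := True))) +
    (1 - p) * measure_pmf.expectation (designation p L) (\<lambda>X. g (X(u := False)))"
proof -
  have split: "measure_pmf.expectation (designation p L) h =
      p * measure_pmf.expectation (designation p (L - {u})) (\<lambda>X. h (X(u := True))) +
      (1 - p) * measure_pmf.expectation (designation p (L - {u})) (\<lambda>X. h (X(u := False)))"
    for h :: "('l \<Rightarrow> bool) \<Rightarrow> real"
  proof -
    have eq: "designation p L = bernoulli_pmf p \<bind>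
        (\<lambda>y. map_pmf (\<lambda>X. X(u := y)) (designation p (L - {u})))"
      using Pi_pmf_insert'[of "L - {u}" u False "\<lambda>_. bernoulli_pmf p"] L
      by (simp add: insert_absorb map_pmf_def)
    have "finite (set_pmf (designation p (L - {u})))"
      using L by (simp add: finite_set_designation)
    then show ?thesis
      unfolding eq using p
      by (subst pmf_expectation_bind[where A = UNIV]) (auto simp: UNIV_bool)
  qed
  \<comment> \<open>The overwritten functions ignore the coin of \<open>u\<close>, so
    \<open>split\<close> shows that their expectations over \<open>L\<close> and
    \<open>L - {u}\<close> agree.\<close>
  show ?thesis
    using split[of g] split[of "\<lambda>X. g (X(u := True))"] split[of "\<lambda>X. g (X(u := False))"]
    by (simp add: algebra_simps)
qed

section \<open>Expected weights by deferred decisions\<close>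

context
  fixes p :: real and L :: "'l set"
  assumes p: "0 \<le> p" "p \<le> 1" and L: "finite L"
begin

abbreviation expect :: "(('l \<Rightarrow> bool) \<Rightarrow> real) \<Rightarrow> real" where
  "expect \<equiv> measure_pmf.expectation (designation p L)"

lemma expect_add: "expect (\<lambda>X. g X + h X) = expect g + expect h"
  using integrable_designation[OF L] by (intro Bochner_Integration.integral_add) auto

lemma expect_mono: "(\<And>X. g X \<le> h X) \<Longrightarrow> expect g \<le> expect h"
  using integrable_designation[OF L] by (intro integral_mono) auto

text \<open>The coin of \<open>fst e\<close> is first read when \<open>e\<close> is considered.
  Afterwards \<open>fst e\<close> is in the used set, so overwriting its coin changes nothing in the
  rest of the scan.\<close>

lemma expect_considered_split:
  assumes "fst e \<in> L" "fst e \<notin> U" "snd e \<notin> C"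
  shows "expect (\<lambda>X. F (sampled (e # es) U C X) (candidates (e # es) U C X)) =
    p * expect (\<lambda>X. F (e # sampled es (insert (fst e) U) (insert (snd e) C) X)
                      (candidates es (insert (fst e) U) (insert (snd e) C) X)) +
    (1 - p) * expect (\<lambda>X. F (sampled es (insert (fst e) U) C X)
                      (e # candidates es (insert (fst e) U) C X))"
proof -
  have 1: "sampled (e # es) U C X = (if X (fst e)
      then e # sampled es (insert (fst e) U) (insert (snd e) C) X
      else sampled es (insert (fst e) U) C X)"
    "candidates (e # es) U C X = (if X (fst e)
      then candidates es (insert (fst e) U) (insert (snd e) C) X
      else e # candidates es (insert (fst e) U) C X)" for X
    using assms by (simp_all add: sampled_def candidates_def)
  show ?thesis
    unfolding 1 by (subst expectation_split[OF L assms(1) p]) (simp add: sampled_upd candidates_upd)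
qed

lemma total_considered:
  "total f (considered es U C X) = total f (sampled es U C X) + total f (candidates es U C X)"
proof -
  have "total f ds = total f (filter P ds) + total f (filter (\<lambda>d. \<not> P d) ds)" for P ds
    by (induction ds) auto
  then show ?thesis unfolding sampled_def candidates_def .
qed

text \<open>An edge is considered before the coin of its left end is read, so it is then sampled
  with probability \<open>p\<close>.\<close>

lemma expect_sampled:
  assumes "fst ` set es \<subseteq> L"
  shows "expect (\<lambda>X. total f (sampled es U C X)) = p * expect (\<lambda>X. total f (considered es U C X))"
  using assms
proof (induction es arbitrary: U C)
  case (Cons e es)
  show ?case
  proof (cases "fst e \<in> U \<or> snd e \<in> C")
    case True
    then show ?thesis using Cons by (simp add: sampled_def)
  next
    case False
    then have e: "fst e \<in> L" "fst e \<notin> U" "snd e \<notin> C" using Cons.prems by auto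
    note S = expect_considered_split[OF e, where F = "\<lambda>s c. total f s"]
    note K = expect_considered_split[OF e, where F = "\<lambda>s c. total f s + total f c"]
    show ?thesis
      unfolding S total_considered K
      using Cons by (simp add: expect_add total_considered algebra_simps)
  qed
qed (simp add: sampled_def)

text \<open>The first considered edge at \<open>r\<close>, if there is one, closes \<open>r\<close>
  with probability \<open>p\<close>, before \<open>r\<close> is a candidate of any vertex.\<close>

lemma expect_not_candidate:
  assumes "fst ` set es \<subseteq> L"
  shows "p \<le> expect (\<lambda>X. if r \<in> snd ` set (candidates es U C X) then 0 else 1)"
  using assms
proof (induction es arbitrary: U C)
  case (Cons e es)
  let ?g = "\<lambda>c. if r \<in> snd ` set c then 0 else (1::real)"
  show ?case
  proof (cases "fst e \<in> U \<or> snd e \<in> C")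
    case True
    then show ?thesis using Cons by (simp add: candidates_def)
  next
    case False
    then have e: "fst e \<in> L" "fst e \<notin> U" "snd e \<notin> C" using Cons.prems by auto
    show ?thesis
    proof (cases "snd e = r")
      case True
      have *: "r \<notin> snd ` set (candidates es (insert (fst e) U) (insert (snd e) C) X)" for X
        using True by (auto simp: candidates_def dest: set_considered)
      show ?thesis
        unfolding expect_considered_split[OF e, where F = "\<lambda>s. ?g"] using * True by simp
    next
      case False
      have "expect (\<lambda>X. ?g (candidates (e # es) U C X)) =
          p * expect (\<lambda>X. ?g (candidates es (insert (fst e) U) (insert (snd e) C) X)) +
          (1 - p) * expect (\<lambda>X. ?g (candidates es (insert (fst e) U) C X))"
        unfolding expect_considered_split[OF e, where F = "\<lambda>s. ?g"] using False by simp
      also have "\<dots> \<ge> p * p + (1 - p) * p"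
        using Cons p by (intro add_mono mult_left_mono) auto
      finally show ?thesis by (simp add: algebra_simps)
    qed
  qed
qed (use p in \<open>simp add: candidates_def\<close>)

text \<open>The coin of its left end makes a considered edge a candidate with probability
  \<open>1 - p\<close>; given that, with probability at least \<open>p\<close> no later candidate
  shares its right end, and \<open>last_total\<close> counts it.\<close>

lemma expect_last_total:
  assumes "fst ` set es \<subseteq> L" and nonneg: "\<And>u r. 0 \<le> f u r"
  shows "p * (1 - p) * expect (\<lambda>X. total f (considered es U C X))
    \<le> expect (\<lambda>X. last_total f (candidates es U C X))"
  using assms(1)
proof (induction es arbitrary: U C)
  case (Cons e es)
  show ?case
  proof (cases "fst e \<in> U \<or> snd e \<in> C")
    case True
    then show ?thesis using Cons by (simp add: candidates_def)
  next
    case False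
    then have e: "fst e \<in> L" "fst e \<notin> U" "snd e \<notin> C" using Cons.prems by auto
    define U' where "U' = insert (fst e) U"
    define C' where "C' = insert (snd e) C"
    define w where "w = f (fst e) (snd e)"
    \<comment> \<open>The closed set is \<open>C\<close> and not \<open>C'\<close>, since an
      undesignated \<open>e\<close> leaves \<open>snd e\<close> open.\<close>
    define P where
      "P = expect (\<lambda>X. if snd e \<in> snd ` set (candidates es U' C X) then 0 else 1)"
    define T1 where "T1 = expect (\<lambda>X. total f (considered es U' C' X))"
    define T2 where "T2 = expect (\<lambda>X. total f (considered es U' C X))"
    define A1 where "A1 = expect (\<lambda>X. last_total f (candidates es U' C' X))"
    define A2 where "A2 = expect (\<lambda>X. last_total f (candidates es U' C X))"
    have 1: "expect (\<lambda>X. total f (considered (e # es) U C X)) = p * (w + T1) + (1 - p) * (w + T2)"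
      unfolding total_considered T1_def T2_def
        expect_considered_split[OF e, where F = "\<lambda>s c. total f s + total f c"]
      by (simp add: expect_add U'_def C'_def w_def algebra_simps)
    have 2: "expect (\<lambda>X. last_total f (candidates (e # es) U C X)) =
        p * A1 + (1 - p) * (w * P + A2)"
    proof -
      have *: "(if b then 0 else w) = w * (if b then 0 else 1)" for b by simp
      show ?thesis
        unfolding expect_considered_split[OF e, where F = "\<lambda>s. last_total f"] A1_def A2_def P_def
          last_total.simps w_def[symmetric] U'_def[symmetric] C'_def[symmetric] expect_add *
        by simp
    qed
    have "p * (1 - p) * T1 \<le> A1" "p * (1 - p) * T2 \<le> A2"
      using Cons by (auto simp: T1_def T2_def A1_def A2_def)
    then have "p * (p * (1 - p) * T1) + (1 - p) * (w * p + p * (1 - p) * T2)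
        \<le> p * A1 + (1 - p) * (w * P + A2)"
      using p expect_not_candidate[of es "snd e" U' C] Cons.prems nonneg
      by (intro add_mono mult_left_mono) (auto simp: P_def w_def)
    then show ?thesis unfolding 1 2 by (simp add: algebra_simps)
  qed
qed (simp add: candidates_def)

lemma weight_le_expect:
  assumes "decreasing f es" "fst ` set es \<subseteq> L" "\<And>u r. 0 \<le> f u r"
    and "M \<subseteq> set es" "inj_on fst M" "inj_on snd M"
  shows "p * (1 - p) / (1 + p) * weight f M \<le> expect (\<lambda>X. last_total f (candidates es {} {} X))"
proof -
  define T where "T = expect (\<lambda>X. total f (considered es {} {} X))"
  have "weight f M = expect (\<lambda>X. weight f M)" by simp
  also have "\<dots> \<le> expect (\<lambda>X. total f (considered es {} {} X) + total f (sampled es {} {} X))"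
    by (intro expect_mono weight_le_considered) (use assms in auto)
  also have "\<dots> = (1 + p) * T"
    using assms by (simp add: expect_add expect_sampled T_def algebra_simps)
  finally have "p * (1 - p) / (1 + p) * weight f M \<le> p * (1 - p) / (1 + p) * ((1 + p) * T)"
    using p by (intro mult_left_mono) auto
  also have "\<dots> = p * (1 - p) * T" using p by (simp add: field_simps)
  also have "\<dots> \<le> expect (\<lambda>X. last_total f (candidates es {} {} X))"
    unfolding T_def using assms by (intro expect_last_total) auto
  finally show ?thesis .
qed

end

section \<open>The online algorithm\<close>

text \<open>Ties are broken by one fixed enumeration of the edges, as sorting is stable. Thus the
  algorithm scans the edges it knows in the same order as they appear among all edges.\<close>

definition edge_list :: "('l, 'r) bigraph \<Rightarrow> ('l \<times> 'r) list" where
  "edge_list G = (SOME es. set es = edges G)"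

definition by_weight :: "('l, 'r) weighting \<Rightarrow> ('l \<times> 'r) list \<Rightarrow> ('l \<times> 'r) list" where
  "by_weight f = sort_key (\<lambda>e. - f (fst e) (snd e))"

text \<open>The filtered edges belong to designated vertices, weighted by the sample, or to the
  arriving vertex, weighted by its revealed vector; so this scan is possible online.\<close>

definition candidate ::
  "('l, 'r) bigraph \<Rightarrow> ('l \<Rightarrow> bool) \<Rightarrow> ('l, 'r) weighting \<Rightarrow> 'l \<times> ('r \<Rightarrow> real) \<Rightarrow> 'r option" where
  "candidate G X s a = (if X (fst a) then None else
     map_of (considered (by_weight (s(fst a := snd a))
       (filter (\<lambda>e. X (fst e) \<or> fst e = fst a) (edge_list G))) {} {} X) (fst a))"

text \<open>A candidate that came up earlier is already taken, so comparing candidates replaces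
  tracking decisions. Without a candidate both branches give \<open>None\<close>.\<close>

definition greedy ::
  "('l, 'r) bigraph \<Rightarrow> ('l \<Rightarrow> bool) \<Rightarrow> ('l, 'r) online_algorithm" where
  "greedy G X s as = (if candidate G X s (last as) \<in> candidate G X s ` set (butlast as)
     then None else candidate G X s (last as))"

definition used ::
  "('l \<Rightarrow> bool) \<Rightarrow> ('l, 'r) weighting \<Rightarrow> ('l, 'r) weighting \<Rightarrow> ('l, 'r) weighting" where
  "used X s w = (\<lambda>u. if X u then s u else w u)"

section \<open>Sorting the edges by weight\<close>

lemma finite_edges: "finite_bigraph G \<Longrightarrow> finite (edges G)"
  using finite_subset[of "edges G" "lefts G \<times> rights G"] by (simp add: finite_bigraph_def)

lemma set_edge_list: "finite_bigraph G \<Longrightarrow> set (edge_list G) = edges G"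
  unfolding edge_list_def by (rule someI_ex) (rule finite_list[OF finite_edges])

lemma set_by_weight [simp]: "set (by_weight f es) = set es"
  by (simp add: by_weight_def)

lemma decreasing_by_weight: "decreasing f (by_weight f es)"
proof -
  have "sorted (map (\<lambda>e. - f (fst e) (snd e)) (by_weight f es))"
    unfolding by_weight_def by (rule sorted_sort_key)
  then show ?thesis by (simp only: sorted_wrt_map neg_le_iff_le)
qed

lemma insort_key_cong:
  "k x = k' x \<Longrightarrow> (\<And>y. y \<in> set ys \<Longrightarrow> k y = k' y) \<Longrightarrow> insort_key k x ys = insort_key k' x ys"
  by (induction ys) auto

lemma sort_key_cong:
  "(\<And>x. x \<in> set xs \<Longrightarrow> k x = k' x) \<Longrightarrow> sort_key k xs = sort_key k' xs"
proof (induction xs)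
  case (Cons x xs)
  then have "sort_key k xs = sort_key k' xs" by simp
  moreover have "insort_key k x (sort_key k' xs) = insort_key k' x (sort_key k' xs)"
    using Cons.prems by (intro insort_key_cong) auto
  ultimately show ?case by simp
qed simp

lemma by_weight_cong:
  assumes "\<And>e. e \<in> set es \<Longrightarrow> f (fst e) = g (fst e)"
  shows "by_weight f es = by_weight g es"
  unfolding by_weight_def using assms by (intro sort_key_cong) simp

lemma map_of_filter_fst:
  assumes "P u"
  shows "map_of (filter (\<lambda>e. P (fst e)) es) u = map_of es u"
  using assms by (induction es) auto

text \<open>Identifies the online computation with a single scan of all edges: dropping the
  undesignated vertices other than \<open>u\<close> commutes with the stable sort and with the
  scan.\<close>

lemma candidate_eq:
  "candidate G X s (u, w u) =
    map_of (candidates (by_weight (used X s w) (edge_list G)) {} {} X) u"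
proof (cases "X u")
  case True
  then have "map_of (candidates (by_weight (used X s w) (edge_list G)) {} {} X) u = None"
    by (auto simp: map_of_eq_None_iff candidates_def)
  then show ?thesis using True by (simp add: candidate_def)
next
  case False
  let ?P = "\<lambda>e. X (fst e) \<or> fst e = u"
  let ?es = "by_weight (used X s w) (edge_list G)"
  have "by_weight (s(u := w u)) (filter ?P (edge_list G)) =
      by_weight (used X s w) (filter ?P (edge_list G))"
    using False by (intro by_weight_cong) (auto simp: used_def)
  also have "\<dots> = filter ?P ?es"
    by (simp add: by_weight_def filter_sort)
  finally have "candidate G X s (u, w u) = map_of (considered (filter ?P ?es) {} {} X) u"
    using False by (simp add: candidate_def)
  also have "considered (filter ?P ?es) {} {} X = filter ?P (considered ?es {} {} X)"
    by (rule filter_considered[symmetric]) simp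
  also have "map_of (filter ?P (considered ?es {} {} X)) u = map_of (considered ?es {} {} X) u"
    using map_of_filter_fst[where P = "\<lambda>v. X v \<or> v = u"] by fast
  also have "\<dots> = map_of (candidates ?es {} {} X) u"
    unfolding candidates_def using map_of_filter_fst[where P = "\<lambda>v. \<not> X v", OF False] by metis
  finally show ?thesis .
qed

lemma candidate_iff:
  "candidate G X s (u, w u) = Some r \<longleftrightarrow>
    (u, r) \<in> set (candidates (by_weight (used X s w) (edge_list G)) {} {} X)"
proof -
  have "distinct (map fst (candidates (by_weight (used X s w) (edge_list G)) {} {} X))"
    unfolding candidates_def by (intro distinct_map_filter distinct_considered)
  then show ?thesis
    unfolding candidate_eq by simp
qed

lemma alg_matching_greedy:
  "alg_matching (greedy G X) s w us = {(us ! i, r) | i r. i < length us \<and>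
     candidate G X s (us ! i, w (us ! i)) = Some r \<and>
     (\<forall>j<i. candidate G X s (us ! j, w (us ! j)) \<noteq> Some r)}"
proof -
  have "greedy G X s (map (\<lambda>u. (u, w u)) (take (Suc i) us)) = Some r \<longleftrightarrow>
     candidate G X s (us ! i, w (us ! i)) = Some r \<and>
     (\<forall>j<i. candidate G X s (us ! j, w (us ! j)) \<noteq> Some r)" if "i < length us" for i r
  proof -
    have "map (\<lambda>u. (u, w u)) (take (Suc i) us) =
        map (\<lambda>u. (u, w u)) (take i us) @ [(us ! i, w (us ! i))]"
      using that by (simp add: take_Suc_conv_app_nth)
    moreover have "set (take i us) = (!) us ` {..<i}"
      using that by (simp add: nth_image lessThan_atLeast0)
    ultimately show ?thesis
      by (auto simp: greedy_def image_iff eq_commute[of "Some r"])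
  qed
  then show ?thesis
    unfolding alg_matching_def by blast
qed

lemma matching_greedy:
  assumes "finite_bigraph G" "distinct us"
  shows "matching G (alg_matching (greedy G X) s w us)"
proof -
  have "alg_matching (greedy G X) s w us \<subseteq> edges G"
    using set_edge_list[OF assms(1)]
    by (auto simp: alg_matching_greedy candidate_iff candidates_def dest!: set_considered)
  moreover have "i = j"
    if "candidate G X s (us ! i, w (us ! i)) = Some r"
      "\<forall>k<i. candidate G X s (us ! k, w (us ! k)) \<noteq> Some r"
      "candidate G X s (us ! j, w (us ! j)) = Some r"
      "\<forall>k<j. candidate G X s (us ! k, w (us ! k)) \<noteq> Some r" for i j r
    using that by (metis linorder_neqE_nat)
  ultimately show ?thesis
    using assms(2) unfolding matching_def alg_matching_greedy
    by (auto simp: nth_eq_iff_index_eq)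
qed

text \<open>The first arrival with candidate \<open>r\<close> receives \<open>r\<close>, so every
  such \<open>r\<close> is matched, by an edge no lighter than the last one.\<close>

lemma last_total_le_greedy:
  assumes G: "finite_bigraph G" and us: "arrival_order G us"
  shows "last_total (used X s w) (candidates (by_weight (used X s w) (edge_list G)) {} {} X)
    \<le> weight w (alg_matching (greedy G X) s w us)"
proof -
  let ?f = "used X s w"
  let ?cs = "candidates (by_weight ?f (edge_list G)) {} {} X"
  let ?M = "alg_matching (greedy G X) s w us"
  have M: "matching G ?M"
    using matching_greedy G us by (auto simp: arrival_order_def)
  then have inj: "inj_on snd ?M"
    by (auto simp: matching_def inj_on_def)
  have sub: "?M \<subseteq> set ?cs"
    by (auto simp: alg_matching_greedy candidate_iff)
  have "snd ` set ?cs \<subseteq> snd ` ?M"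
  proof
    fix r assume "r \<in> snd ` set ?cs"
    then obtain u where u: "(u, r) \<in> set ?cs" by auto
    then have "u \<in> lefts G"
      using set_edge_list[OF G] G
      by (auto simp: candidates_def finite_bigraph_def dest!: set_considered)
    then obtain i where i: "i < length us" "us ! i = u"
      using us by (metis arrival_order_def in_set_conv_nth)
    let ?Q = "\<lambda>i. i < length us \<and> candidate G X s (us ! i, w (us ! i)) = Some r"
    have "?Q i" using i u by (simp add: candidate_iff)
    then obtain k where k: "?Q k" "\<forall>j<k. \<not> ?Q j"
      using exists_least_iff[of ?Q] by auto
    have "candidate G X s (us ! j, w (us ! j)) \<noteq> Some r" if "j < k" for j
      using k that less_trans by blast
    then have "(us ! k, r) \<in> ?M"
      unfolding alg_matching_greedy using k(1) by blast
    then show "r \<in> snd ` ?M" by force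
  qed
  then have img: "snd ` set ?cs = snd ` ?M" using sub by auto
  \<comment> \<open>\<open>h r\<close> is the weight of the edge matched to \<open>r\<close>,
    recovered by injectivity of \<open>snd\<close> on the matching.\<close>
  define h where "h = (\<lambda>r. let e = the_inv_into ?M snd r in ?f (fst e) (snd e))"
  have h: "h (snd e) = ?f (fst e) (snd e)" if "e \<in> ?M" for e
    using the_inv_into_f_f[OF inj that] by (simp add: h_def)
  have "last_total ?f ?cs \<le> (\<Sum>r\<in>snd ` set ?cs. h r)"
  proof (rule last_total_le)
    show "decreasing ?f ?cs"
      unfolding candidates_def
      by (intro sorted_wrt_filter considered_sorted decreasing_by_weight)
    fix r assume "r \<in> snd ` set ?cs"
    then obtain e where "e \<in> ?M" "snd e = r" using img by auto
    then show "\<exists>e\<in>set ?cs. snd e = r \<and> ?f (fst e) (snd e) \<le> h r"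
      using sub h by fastforce
  qed
  also have "\<dots> = (\<Sum>e\<in>?M. ?f (fst e) (snd e))"
    unfolding img by (simp add: sum.reindex[OF inj] h)
  \<comment> \<open>Matched edges have undesignated left ends, where \<open>used X s w\<close>
    agrees with \<open>w\<close>.\<close>
  also have "\<dots> = weight w ?M"
    unfolding weight_def case_prod_beta using sub
    by (intro sum.cong) (auto simp: used_def candidates_def)
  finally show ?thesis .
qed

section \<open>The competitive ratio\<close>

text \<open>A fair coin stays fair when flipped. Off \<open>lefts G\<close> both \<open>b\<close>
  and \<open>X\<close> are false, which preserves the default value.\<close>

lemma map_coins_xor:
  assumes "finite (lefts G)" "\<And>u. u \<notin> lefts G \<Longrightarrow> \<not> X u"
  shows "map_pmf (\<lambda>b u. b u \<noteq> X u) (coins G) = coins G"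
proof -
  have "map_pmf (\<lambda>y. y \<noteq> c) (bernoulli_pmf (1/2)) = bernoulli_pmf (1/2)" for c
  proof (rule pmf_eqI)
    fix i
    have "inj (\<lambda>y. y \<noteq> c)" by (auto simp: inj_def)
    then have "pmf (map_pmf (\<lambda>y. y \<noteq> c) (bernoulli_pmf (1/2))) ((i \<noteq> c) \<noteq> c) =
        pmf (bernoulli_pmf (1/2)) (i \<noteq> c)"
      by (rule pmf_map_inj')
    then show "pmf (map_pmf (\<lambda>y. y \<noteq> c) (bernoulli_pmf (1/2))) i = pmf (bernoulli_pmf (1/2)) i"
      by (cases i; cases c) simp_all
  qed
  then have "coins G = Pi_pmf (lefts G) False
      (\<lambda>u. bernoulli_pmf (1/2) \<bind> (\<lambda>y. return_pmf (y \<noteq> X u)))"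
    by (simp add: coins_def map_pmf_def)
  also have "\<dots> = coins G \<bind> (\<lambda>b. return_pmf (\<lambda>u. if u \<in> lefts G then b u \<noteq> X u else False))"
    unfolding coins_def
    by (subst Pi_pmf_bind[OF assms(1), where d' = False]) (simp add: assms(1))
  also have "\<dots> = coins G \<bind> (\<lambda>b. return_pmf (\<lambda>u. b u \<noteq> X u))"
  proof (rule bind_pmf_cong[OF refl], rule arg_cong[where f = return_pmf], rule ext)
    fix b u assume "b \<in> set_pmf (coins G)"
    then have "\<not> b u" if "u \<notin> lefts G"
      using designation_outside[OF assms(1)] that unfolding coins_def by blast
    then show "(if u \<in> lefts G then b u \<noteq> X u else False) = (b u \<noteq> X u)"
      using assms(2) by auto
  qed
  finally show ?thesis by (simp add: map_pmf_def)
qed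

text \<open>The flipped coins have the same law for every fixed \<open>X\<close>, hence are again
  independent of \<open>X\<close>.\<close>

lemma map_pair_coins_xor:
  assumes "finite (lefts G)"
  shows "map_pmf (\<lambda>(b, X). (\<lambda>u. b u \<noteq> X u, X)) (pair_pmf (coins G) (designation p (lefts G))) =
    pair_pmf (coins G) (designation p (lefts G))"
proof -
  let ?D = "designation p (lefts G)"
  have pair: "pair_pmf (coins G) ?D = ?D \<bind> (\<lambda>X. map_pmf (\<lambda>b. (b, X)) (coins G))"
    unfolding pair_pmf_def map_pmf_def by (rule bind_commute_pmf)
  have "map_pmf (\<lambda>(b, X). (\<lambda>u. b u \<noteq> X u, X)) (pair_pmf (coins G) ?D) =
      ?D \<bind> (\<lambda>X. map_pmf (\<lambda>b. (b, X)) (map_pmf (\<lambda>b u. b u \<noteq> X u) (coins G)))"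
    unfolding pair map_bind_pmf by (simp add: pmf.map_comp o_def)
  also have "\<dots> = pair_pmf (coins G) ?D"
    unfolding pair
  proof (rule bind_pmf_cong[OF refl])
    fix X assume "X \<in> set_pmf ?D"
    then have "\<not> X u" if "u \<notin> lefts G" for u
      using designation_outside[OF assms] that by blast
    then show "map_pmf (\<lambda>b. (b, X)) (map_pmf (\<lambda>b u. b u \<noteq> X u) (coins G)) =
        map_pmf (\<lambda>b. (b, X)) (coins G)"
      using map_coins_xor[OF assms] by simp
  qed
  finally show ?thesis .
qed

lemma OPT_le_expect:
  assumes G: "finite_bigraph G" and p: "0 \<le> p" "p \<le> 1" and f: "\<And>u r. 0 \<le> f u r"
  shows "p * (1 - p) / (1 + p) * OPT G f \<le> measure_pmf.expectation (designation p (lefts G))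
    (\<lambda>X. last_total f (candidates (by_weight f (edge_list G)) {} {} X))"
proof -
  have "finite {M. matching G M}"
    by (rule finite_subset[of _ "Pow (edges G)"]) (auto simp: matching_def finite_edges[OF G])
  moreover have "matching G {}" by (simp add: matching_def)
  ultimately have "OPT G f \<in> weight f ` {M. matching G M}"
    unfolding OPT_def by (intro Max_in) auto
  then obtain M where M: "matching G M" and OPT: "OPT G f = weight f M" by auto
  have "inj_on fst M" "inj_on snd M"
    using M by (auto simp: matching_def inj_on_def)
  moreover have "fst ` edges G \<subseteq> lefts G"
    using G by (auto simp: finite_bigraph_def)
  ultimately show ?thesis
    unfolding OPT using G M p f
    by (intro weight_le_expect)
      (auto simp: finite_bigraph_def set_edge_list matching_def decreasing_by_weight)
qed

definition greedy_algorithm :: "real \<Rightarrow> ('l, 'r) randomized_algorithm" where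
  "greedy_algorithm p G = map_pmf (greedy G) (designation p (lefts G))"

lemma valid_greedy_algorithm: "valid_algorithm (greedy_algorithm p)"
  by (auto simp: valid_algorithm_def greedy_algorithm_def feasible_def arrival_order_def
      matching_greedy)

lemma competitive_greedy_algorithm:
  assumes p: "0 \<le> p" "p \<le> 1"
  shows "competitive (p * (1 - p) / (1 + p)) (greedy_algorithm p :: ('l, 'r) randomized_algorithm)"
  unfolding competitive_def
proof (intro allI impI)
  fix G :: "('l, 'r) bigraph" and f1 f2
    and ord :: "('l, 'r) weighting \<Rightarrow> ('l, 'r) weighting \<Rightarrow> 'l list"
  assume G: "finite_bigraph G" and f: "edge_weighting G f1" "edge_weighting G f2"
    and ord: "\<forall>s w. arrival_order G (ord s w)"
  define c where "c = p * (1 - p) / (1 + p)"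
  define D where "D = designation p (lefts G)"
  define P where "P = pair_pmf (coins G) D"
  define Q where
    "Q f X = last_total f (candidates (by_weight f (edge_list G)) {} {} X)" for f and X :: "'l \<Rightarrow> bool"
  let ?s = "sample f1 f2" and ?w = "remaining f1 f2"
  have fin: "finite (lefts G)" using G by (simp add: finite_bigraph_def)
  have finD: "finite (set_pmf D)"
    unfolding D_def using fin by (rule finite_set_designation)
  have finC: "finite (set_pmf (coins G))"
    unfolding coins_def using fin by (rule finite_set_designation)
  have finP: "finite (set_pmf P)" using finD finC by (simp add: P_def)
  \<comment> \<open>Using the sample at \<open>u\<close> amounts to using the remaining vector under
    the flipped coin.\<close>
  have used: "used X (?s b) (?w b) = ?w (\<lambda>u. b u \<noteq> X u)" for X b
    by (auto simp: used_def sample_def remaining_def)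
  have "c * expected_OPT G f1 f2 = measure_pmf.expectation (coins G) (\<lambda>b. c * OPT G (?w b))"
    by (simp add: expected_OPT_def)
  also have "\<dots> \<le> measure_pmf.expectation (coins G) (\<lambda>b. measure_pmf.expectation D (Q (?w b)))"
  proof (intro integral_mono integrable_measure_pmf_finite finC)
    fix b
    have "0 \<le> ?w b u r" for u r
      using f by (simp add: remaining_def edge_weighting_def)
    then show "c * OPT G (?w b) \<le> measure_pmf.expectation D (Q (?w b))"
      unfolding c_def D_def Q_def using G p by (intro OPT_le_expect)
  qed
  also have "\<dots> = measure_pmf.expectation P (\<lambda>(b, X). Q (?w b) X)"
  proof -
    have "P = coins G \<bind> (\<lambda>b. map_pmf (Pair b) D)"
      by (simp add: P_def pair_pmf_def map_pmf_def)
    then show ?thesis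
      using finC finD
      by (simp add: pmf_expectation_bind[where A = "set_pmf (coins G)"]
          integral_measure_pmf[where A = "set_pmf (coins G)"])
  qed
  \<comment> \<open>This change of variables turns the scanned weights into those that the algorithm
    uses.\<close>
  also have "\<dots> = measure_pmf.expectation (map_pmf (\<lambda>(b, X). (\<lambda>u. b u \<noteq> X u, X)) P)
      (\<lambda>(b, X). Q (?w b) X)"
    unfolding P_def D_def map_pair_coins_xor[OF fin] ..
  also have "\<dots> = measure_pmf.expectation P (\<lambda>(b, X). Q (used X (?s b) (?w b)) X)"
    by (simp add: case_prod_unfold used)
  also have "\<dots> \<le> measure_pmf.expectation P
      (\<lambda>(b, X). weight (?w b) (alg_matching (greedy G X) (?s b) (?w b) (ord (?s b) (?w b))))"
  proof (rule integral_mono[OF integrable_measure_pmf_finite[OF finP]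
        integrable_measure_pmf_finite[OF finP]], clarify)
    fix b X
    show "Q (used X (?s b) (?w b)) X
        \<le> weight (?w b) (alg_matching (greedy G X) (?s b) (?w b) (ord (?s b) (?w b)))"
      unfolding Q_def using ord by (intro last_total_le_greedy[OF G]) blast
  qed
  also have "\<dots> = expected_ALG (greedy_algorithm p) G f1 f2 ord"
  proof -
    have "pair_pmf (coins G) (greedy_algorithm p G) = map_pmf (\<lambda>(b, X). (b, greedy G X)) P"
      using pair_map_pmf2[of "coins G" "greedy G" D]
      by (simp add: greedy_algorithm_def P_def D_def apsnd_def map_prod_def)
    then show ?thesis
      by (simp add: expected_ALG_def Let_def case_prod_unfold)
  qed
  finally show "c * expected_OPT G f1 f2 \<le> expected_ALG (greedy_algorithm p) G f1 f2 ord" .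
qed

theorem corollary4p7:
  "\<exists>A :: ('l, 'r) randomized_algorithm.
     valid_algorithm A \<and> competitive (3 - 2 * sqrt 2) A"
proof -
  have "0 \<le> sqrt 2 - 1" "sqrt 2 - 1 \<le> (1::real)"
    by (auto simp: real_le_rsqrt real_le_lsqrt)
  \<comment> \<open>The choice \<open>sqrt 2 - 1\<close> maximizes
    \<open>p * (1 - p) / (1 + p)\<close> on the unit interval; it is the positive root of
    \<open>p^2 + 2 * p = 1\<close>.\<close>
  moreover have "(sqrt 2 - 1) * (1 - (sqrt 2 - 1)) / (1 + (sqrt 2 - 1)) = 3 - 2 * sqrt (2::real)"
    by (simp add: field_simps)
  ultimately have "competitive (3 - 2 * sqrt 2) (greedy_algorithm (sqrt 2 - 1)
      :: ('l, 'r) randomized_algorithm)"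
    using competitive_greedy_algorithm[of "sqrt 2 - 1"] by simp
  then show ?thesis using valid_greedy_algorithm by blast
qed

end
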